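(* Let $n\ge 1$ and let $G$ be (the skeleton graph of) any triangulation of the $(n+2)$-gon. Then the total number of faces of the graphical zonotope $Z_G$ is $$\begin{pmatrix}1&1\end{pmatrix}\begin{pmatrix}1&1\\2&4\end{pmatrix}^{n}\begin{pmatrix}1\\2\end{pmatrix},$$ which is also equal to $$3\sum_{\frac{n}{2}\le m\le n}\binom{m}{n-m}5^{2m-n}(-2)^{n-m}\;-\;2\sum_{\frac{n-1}{2}\le m\le n-1}\binom{m}{n-m-1}5^{2m-n+1}(-2)^{n-m-1},$$ where the sums run over integers $m$ in the indicated ranges.
   Context: The $N$-gon is a $2$-dimensional convex polytope with $N$ edges. A triangulation of the $N$-gon is a subdivision of it into triangles by non-crossing diagonals, using only the $N$ vertices of the polygon; its skeleton graph is the graph on the $N$ polygon vertices (labelled $1,\dots,N$) whose edges are the sides of the polygon together with the diagonals used in the triangulation. For a simple connected graph $G$ on vertex set $\{1,\dots,N\}$ with edge set $E(G)$, the graphical zonotope is the Minkowski sum $Z_G=\sum_{ij\in E(G)}[e_i,e_j]\subset\mathbb{R}^N$, where $e_1,\dots,e_N$ are the coordinate vectors of $\mathbb{R}^N$. The total number of faces counts all nonempty faces of $Z_G$ of every dimension $0,1,\dots,N-1$, including $Z_G$ itself (and excluding the empty face). *)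

theory Defs
  imports "HOL-Analysis.Analysis" "HOL-Library.Set_Algebras"
begin

definition polygon :: "nat \<Rightarrow> (real^2) set \<Rightarrow> bool" where
  "polygon N P \<longleftrightarrow> polytope P \<and> aff_dim P = 2 \<and> card {e. e edge_of P} = N"

text \<open>
  A triangulation is given by its set of triangles. The predicate \<open>triangulation\<close> of the library
  says that any two of them meet in a common (possibly empty) face; in particular the diagonals
  used do not cross.
\<close>

definition polygon_triangulation :: "(real^2) set \<Rightarrow> (real^2) set set \<Rightarrow> bool" where
  "polygon_triangulation P \<T> \<longleftrightarrow>
     triangulation \<T> \<and>
     (\<forall>T\<in>\<T>. 2 simplex T \<and> {x. x extreme_point_of T} \<subseteq> {x. x extreme_point_of P}) \<and>
     \<Union>\<T> = P"

definition polygon_sides :: "(real^2) set \<Rightarrow> (real^2) set set" where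
  "polygon_sides P = {s. s edge_of P}"

definition diagonals_used :: "(real^2) set \<Rightarrow> (real^2) set set \<Rightarrow> (real^2) set set" where
  "diagonals_used P \<T> = {d. \<exists>T\<in>\<T>. d edge_of T} - polygon_sides P"

text \<open>
  Graphs on the vertex set \<open>UNIV :: 'k set\<close> are given by their edge sets, an edge being a
  two-element set. The map \<open>v\<close> assigns to each label the corresponding vertex of the polygon.
\<close>

definition skeleton_edges :: "('k \<Rightarrow> real^2) \<Rightarrow> (real^2) set \<Rightarrow> (real^2) set set \<Rightarrow> 'k set set" where
  "skeleton_edges v P \<T> =
     {{i, j} | i j. i \<noteq> j \<and> closed_segment (v i) (v j) \<in> polygon_sides P \<union> diagonals_used P \<T>}"

text \<open>
  The sum is the Minkowski sum of sets (\<open>Set_Algebras\<close>). As edges are unordered, the segment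
  with endpoints \<open>axis i 1\<close> and \<open>axis j 1\<close> is written as the convex hull of these two points.
\<close>

definition graphical_zonotope :: "'k::finite set set \<Rightarrow> (real^'k) set" where
  "graphical_zonotope E = (\<Sum>e\<in>E. convex hull ((\<lambda>i. axis i 1) ` e))"

definition num_faces :: "'a::real_vector set \<Rightarrow> nat" where
  "num_faces Z = card {F. F face_of Z \<and> F \<noteq> {}}"

text \<open>
  Powers with respect to the matrix product \<open>**\<close>; the operation \<open>*\<close> on the type \<open>vec\<close>
  (and hence \<open>^\<close>) is componentwise.
\<close>

definition matrix_power :: "real^'n^'n \<Rightarrow> nat \<Rightarrow> real^'n^'n" where
  "matrix_power A k = (((**) A) ^^ k) (mat 1)"

end

theory Submission
  imports Defs
begin

text \<open>
  Every nonempty face of a polytope maximises some linear form \<open>c\<close>. A maximiser over a Minkowski sum is a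
  sum of maximisers, so the face of the graphical zonotope belonging to \<open>c\<close> is determined by, and determines,
  the order relation of \<open>c i\<close> and \<open>c j\<close> for all edges \<open>i j\<close> (the state of \<open>c\<close>).

  States are counted separately according to the sign on a distinguished side \<open>i j\<close> of the polygon. The
  triangle \<open>i j k\<close> on that side cuts the rest into two triangulated polygons with distinguished sides \<open>i k\<close>
  and \<open>k j\<close>. If \<open>a\<close> states have \<open>c i = c j\<close> and \<open>b\<close> states have \<open>c i < c j\<close>, then gluing along the
  triangle multiplies the elements \<open>a + b x\<close> of \<open>\<int>[x] / (x\<^sup>2 - 3 x - 2)\<close>. A single edge has the value \<open>1 + x\<close>,
  hence a triangulation with \<open>n\<close> triangles has the value \<open>(1 + x) ^ (n + 1)\<close>, independently of its shape, and
  \<open>a + 2 b\<close> states.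
\<close>

subsection \<open>The transfer matrix and the binomial sums\<close>

text \<open>Closed form of the Lucas sequence with characteristic polynomial
  \<open>t^2 - p t - q\<close>. The sums of the theorem have \<open>p = 5\<close>, the trace of the
  transfer matrix, and \<open>q = -2\<close>, minus its determinant.\<close>

definition lucas_sum :: "'a::comm_ring_1 \<Rightarrow> 'a \<Rightarrow> nat \<Rightarrow> 'a" where
  "lucas_sum p q n = (\<Sum>k\<le>n. of_nat ((n - k) choose k) * p ^ (n - 2 * k) * q ^ k)"

lemma lucas_sum_0 [simp]: "lucas_sum p q 0 = 1" and lucas_sum_1 [simp]: "lucas_sum p q (Suc 0) = p"
  by (simp_all add: lucas_sum_def)

text \<open>Pascal's rule splits summand \<open>k + 1\<close> of the left side into summand
  \<open>k + 1\<close> of the first term and summand \<open>k\<close> of the second.\<close>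

lemma lucas_sum_rec: "lucas_sum p q (Suc (Suc n)) = p * lucas_sum p q (Suc n) + q * lucas_sum p q n"
proof -
  have summand: "of_nat ((Suc (Suc n) - Suc k) choose Suc k) * p ^ (Suc (Suc n) - 2 * Suc k) * q ^ Suc k
     = p * (of_nat ((Suc n - Suc k) choose Suc k) * p ^ (Suc n - 2 * Suc k) * q ^ Suc k)
       + q * (of_nat ((n - k) choose k) * p ^ (n - 2 * k) * q ^ k)" if "k \<le> n" for k
  proof -
    have "Suc (Suc n) - Suc k = Suc (n - k)" using that by simp
    then have c: "(Suc (Suc n) - Suc k) choose Suc k = ((n - k) choose k) + ((n - k) choose Suc k)" by simp
    \<comment> \<open>Where truncated subtraction would spoil the exponents, the binomial
      coefficient vanishes.\<close>
    have p: "of_nat ((n - k) choose Suc k) * p ^ (n - 2 * k) = p * (of_nat ((n - k) choose Suc k) * p ^ (Suc n - 2 * Suc k))"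
    proof (cases "Suc k \<le> n - k")
      case True
      then have "n - 2 * k = Suc (Suc n - 2 * Suc k)" by simp
      then show ?thesis by (simp add: algebra_simps)
    qed (simp add: binomial_eq_0)
    show ?thesis unfolding c using p by (simp add: algebra_simps)
  qed
  let ?f = "\<lambda>m k. of_nat ((m - k) choose k) * p ^ (m - 2 * k) * q ^ k"
  have "lucas_sum p q (Suc (Suc n)) = ?f (Suc (Suc n)) 0 + (\<Sum>k\<le>Suc n. ?f (Suc (Suc n)) (Suc k))"
    unfolding lucas_sum_def by (rule sum.atMost_Suc_shift)
  \<comment> \<open>The last summand contains \<open>0 choose Suc (Suc n)\<close>, which is
    zero.\<close>
  also have "(\<Sum>k\<le>Suc n. ?f (Suc (Suc n)) (Suc k)) = (\<Sum>k\<le>n. ?f (Suc (Suc n)) (Suc k))"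
    by simp
  also have "\<dots> = (\<Sum>k\<le>n. p * ?f (Suc n) (Suc k) + q * ?f n k)"
    by (intro sum.cong refl summand) simp
  also have "\<dots> = p * (\<Sum>k\<le>n. ?f (Suc n) (Suc k)) + q * lucas_sum p q n"
    by (simp only: sum.distrib sum_distrib_left lucas_sum_def)
  also have "?f (Suc (Suc n)) 0 + \<dots> = p * (?f (Suc n) 0 + (\<Sum>k\<le>n. ?f (Suc n) (Suc k))) + q * lucas_sum p q n"
    by (simp add: algebra_simps)
  also have "?f (Suc n) 0 + (\<Sum>k\<le>n. ?f (Suc n) (Suc k)) = lucas_sum p q (Suc n)"
    unfolding lucas_sum_def by (rule sum.atMost_Suc_shift[symmetric])
  finally show ?thesis .
qed

text \<open>Substitute \<open>m = n - k\<close>; indices below \<open>n / 2\<close> contribute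
  nothing because there \<open>m < n - m\<close>.\<close>

lemma lucas_sum_alt:
  "lucas_sum p q n = (\<Sum>m | real n / 2 \<le> real m \<and> m \<le> n. of_nat (m choose (n - m)) * p ^ (2 * m - n) * q ^ (n - m))"
proof -
  have "lucas_sum p q n = (\<Sum>m\<le>n. of_nat (m choose (n - m)) * p ^ (2 * m - n) * q ^ (n - m))"
    unfolding lucas_sum_def
  proof (rule sum.reindex_bij_witness[of _ "\<lambda>m. n - m" "\<lambda>m. n - m"], goal_cases)
    case (5 k)
    then have "2 * (n - k) - n = n - 2 * k" by auto
    with 5 show ?case by simp
  qed auto
  also have "\<dots> = (\<Sum>m | real n / 2 \<le> real m \<and> m \<le> n. of_nat (m choose (n - m)) * p ^ (2 * m - n) * q ^ (n - m))"
  proof (rule sum.mono_neutral_right)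
    show "\<forall>m\<in>{..n} - {m. real n / 2 \<le> real m \<and> m \<le> n}. of_nat (m choose (n - m)) * p ^ (2 * m - n) * q ^ (n - m) = 0"
    proof
      fix m assume "m \<in> {..n} - {m. real n / 2 \<le> real m \<and> m \<le> n}"
      then have "m < n - m" by auto
      then show "of_nat (m choose (n - m)) * p ^ (2 * m - n) * q ^ (n - m) = 0"
        by (simp add: binomial_eq_0)
    qed
  qed auto
  finally show ?thesis .
qed

text \<open>
  The pair \<open>(a, b)\<close> at \<open>n\<close> consists of the coefficients of \<open>(1 + x) ^ (n + 1) = a + b x\<close> in the ring
  \<open>\<int>[x] / (x\<^sup>2 - 3 x - 2)\<close>; see \<open>state_count_glue\<close>.
\<close>

fun state_count :: "nat \<Rightarrow> nat \<times> nat" where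
  "state_count 0 = (1, 1)"
| "state_count (Suc n) = (case state_count n of (a, b) \<Rightarrow> (a + 2 * b, a + 4 * b))"

text \<open>The second coordinate is \<open>2 b\<close> because it collects both strict orders of
  the distinguished side; pairing with \<open>(1, 1)\<close> then yields
  \<open>a + 2 b\<close>.\<close>

lemma matrix_power_state_count:
  "matrix_power (vector [vector [1, 1], vector [2, 4]] :: real^2^2) n *v vector [1, 2]
     = vector [real (fst (state_count n)), 2 * real (snd (state_count n))]"
proof (induction n)
  case 0
  then show ?case by (simp add: matrix_power_def matrix_vector_mul_lid)
next
  case (Suc n)
  let ?M = "vector [vector [1, 1], vector [2, 4]] :: real^2^2"
  have "matrix_power ?M (Suc n) *v vector [1, 2] = ?M *v (matrix_power ?M n *v vector [1, 2])"
    by (simp add: matrix_power_def matrix_vector_mul_assoc)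
  then show ?case
    unfolding Suc by (simp add: vec_eq_iff forall_2 matrix_vector_mult_def sum_2 vector_2 split: prod.split)
qed

text \<open>By Cayley-Hamilton both sides satisfy \<open>t (n + 2) = 5 t (n + 1) - 2 t n\<close>, so
  two initial values suffice.\<close>

lemma state_count_lucas:
  "real (fst (state_count (Suc n)) + 2 * snd (state_count (Suc n))) = 3 * lucas_sum 5 (- 2) (Suc n) - 2 * lucas_sum 5 (- 2) n"
proof (induction n rule: induct_nat_012)
  case (ge2 n)
  let ?t = "\<lambda>n. real (fst (state_count n) + 2 * snd (state_count n))"
  have "?t (Suc (Suc (Suc n))) = 5 * ?t (Suc (Suc n)) - 2 * ?t (Suc n)"
    by (simp split: prod.split)
  then show ?case unfolding ge2 by (simp only: lucas_sum_rec) (simp add: algebra_simps)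
qed (simp_all add: lucas_sum_rec)

lemma matrix_formula_eq_binomial_formula:
  assumes "n \<ge> 1"
  shows "(vector [1, 1] :: real^2) \<bullet>
             (matrix_power (vector [vector [1, 1], vector [2, 4]]) n *v vector [1, 2]) =
           3 * (\<Sum>m | real n / 2 \<le> real m \<and> m \<le> n.
                  real (m choose (n - m)) * 5 ^ (2 * m - n) * (-2) ^ (n - m))
           - 2 * (\<Sum>m | (real n - 1) / 2 \<le> real m \<and> m \<le> n - 1.
                  real (m choose (n - m - 1)) * 5 ^ (2 * m + 1 - n) * (-2) ^ (n - m - 1))"
proof -
  obtain k where k: "n = Suc k" using assms by (cases n) auto
  have "(vector [1, 1] :: real^2) \<bullet>
      (matrix_power (vector [vector [1, 1], vector [2, 4]]) n *v vector [1, 2]) =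
      real (fst (state_count n) + 2 * snd (state_count n))"
    unfolding matrix_power_state_count by (simp add: inner_vec_def sum_2)
  also have "\<dots> = 3 * lucas_sum 5 (- 2) n - 2 * lucas_sum 5 (- 2) k"
    unfolding k by (rule state_count_lucas)
  finally show ?thesis
    unfolding lucas_sum_alt by (simp add: k)
qed

subsection \<open>Faces of Minkowski sums of segments\<close>

definition max_face :: "'a::real_inner set \<Rightarrow> 'a \<Rightarrow> 'a set" where
  "max_face Z c = {x\<in>Z. \<forall>y\<in>Z. c \<bullet> y \<le> c \<bullet> x}"

lemma max_face_nonempty:
  assumes "compact Z" "Z \<noteq> {}"
  shows "max_face Z c \<noteq> {}"
proof -
  have "continuous_on Z (\<lambda>x. c \<bullet> x)" by (intro continuous_intros)
  from continuous_attains_sup[OF assms this] show ?thesis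
    by (auto simp: max_face_def)
qed

text \<open>Exchange argument: replacing only the summand \<open>s k\<close> by a better one would
  improve the whole sum.\<close>

lemma max_face_set_sum_component:
  assumes "finite I" "\<forall>i\<in>I. s i \<in> S i" "sum s I \<in> max_face (sum S I) c" "k \<in> I"
  shows "s k \<in> max_face (S k) c"
proof -
  have "c \<bullet> y \<le> c \<bullet> s k" if "y \<in> S k" for y
  proof -
    have "sum (s(k := y)) I \<in> sum S I"
      unfolding set_sum_alt[OF assms(1)] using assms(2) that by (intro CollectI exI[of _ "s(k := y)"]) auto
    then have "c \<bullet> sum (s(k := y)) I \<le> c \<bullet> sum s I"
      using assms(3) by (auto simp: max_face_def)
    moreover have "sum (s(k := y)) I = y + sum s (I - {k})"
      using assms(1,4) by (simp add: sum.remove[of I k])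
    moreover have "sum s I = s k + sum s (I - {k})"
      using assms(1,4) by (simp add: sum.remove[of I k])
    ultimately show ?thesis by (simp add: inner_add_right)
  qed
  with assms(2,4) show ?thesis by (auto simp: max_face_def)
qed

lemma sum_in_max_face_set_sum:
  assumes "finite I" "\<forall>i\<in>I. s i \<in> max_face (S i) c"
  shows "sum s I \<in> max_face (sum S I) c"
proof -
  have "sum s I \<in> sum S I"
    unfolding set_sum_alt[OF assms(1)] using assms(2) by (auto simp: max_face_def)
  moreover have "c \<bullet> y \<le> c \<bullet> sum s I" if "y \<in> sum S I" for y
  proof -
    from that obtain r where "y = sum r I" "\<forall>i\<in>I. r i \<in> S i"
      unfolding set_sum_alt[OF assms(1)] by auto
    with assms(2) show ?thesis
      by (auto simp: inner_sum_right max_face_def intro!: sum_mono)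
  qed
  ultimately show ?thesis by (simp add: max_face_def)
qed

lemma max_face_set_sum_subset_iff:
  assumes fin: "finite I" and S: "\<And>i. i \<in> I \<Longrightarrow> compact (S i) \<and> S i \<noteq> {}"
  shows "max_face (sum S I) c \<subseteq> max_face (sum S I) d \<longleftrightarrow>
    (\<forall>i\<in>I. max_face (S i) c \<subseteq> max_face (S i) d)"
proof
  assume L: "max_face (sum S I) c \<subseteq> max_face (sum S I) d"
  show "\<forall>i\<in>I. max_face (S i) c \<subseteq> max_face (S i) d"
  proof (intro ballI subsetI)
    fix i x assume i: "i \<in> I" and x: "x \<in> max_face (S i) c"
    have "\<exists>y. y \<in> max_face (S j) c" if "j \<in> I" for j
      using max_face_nonempty[of "S j" c] S[OF that] by blast
    then obtain s where s: "\<And>j. j \<in> I \<Longrightarrow> s j \<in> max_face (S j) c" by metis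
    \<comment> \<open>Completing \<open>x\<close> by arbitrary maximisers in the other summands
      gives a maximiser of the sum, from which component \<open>i\<close> is read off again.\<close>
    let ?s = "s(i := x)"
    have s': "\<forall>j\<in>I. ?s j \<in> max_face (S j) c" using s x by auto
    have "sum ?s I \<in> max_face (sum S I) d"
      by (rule subsetD[OF L sum_in_max_face_set_sum[OF fin s']])
    moreover have "\<forall>j\<in>I. ?s j \<in> S j" using s' by (simp add: max_face_def)
    ultimately have "?s i \<in> max_face (S i) d"
      using max_face_set_sum_component[OF fin] i by blast
    then show "x \<in> max_face (S i) d" by simp
  qed
next
  assume R: "\<forall>i\<in>I. max_face (S i) c \<subseteq> max_face (S i) d"
  show "max_face (sum S I) c \<subseteq> max_face (sum S I) d"
  proof
    fix x assume x: "x \<in> max_face (sum S I) c"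
    then have "x \<in> sum S I" by (simp add: max_face_def)
    then obtain s where s: "x = sum s I" "\<forall>i\<in>I. s i \<in> S i"
      unfolding set_sum_alt[OF fin] by auto
    then have "\<forall>i\<in>I. s i \<in> max_face (S i) c"
      using max_face_set_sum_component[OF fin s(2)] x by simp
    then have "\<forall>i\<in>I. s i \<in> max_face (S i) d" using R by blast
    then show "x \<in> max_face (sum S I) d"
      unfolding s(1) by (rule sum_in_max_face_set_sum[OF fin])
  qed
qed

lemma max_face_segment_subset_iff:
  "max_face (closed_segment a b) c \<subseteq> max_face (closed_segment a b) d \<longleftrightarrow>
    (c \<bullet> a \<le> c \<bullet> b \<longrightarrow> d \<bullet> a \<le> d \<bullet> b) \<and> (c \<bullet> b \<le> c \<bullet> a \<longrightarrow> d \<bullet> b \<le> d \<bullet> a)"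
proof -
  \<comment> \<open>An endpoint that enters the point with positive weight must itself be
    maximal.\<close>
  have mem: "(1 - u) *\<^sub>R a + u *\<^sub>R b \<in> max_face (closed_segment a b) f \<longleftrightarrow>
      (u < 1 \<longrightarrow> f \<bullet> b \<le> f \<bullet> a) \<and> (0 < u \<longrightarrow> f \<bullet> a \<le> f \<bullet> b)" (is "?L \<longleftrightarrow> ?R")
    if u: "0 \<le> u" "u \<le> 1" for u f
  proof
    assume ?L
    then have *: "f \<bullet> a \<le> f \<bullet> ((1 - u) *\<^sub>R a + u *\<^sub>R b)" "f \<bullet> b \<le> f \<bullet> ((1 - u) *\<^sub>R a + u *\<^sub>R b)"
      by (simp_all add: max_face_def)
    have "0 \<le> u * (f \<bullet> b - f \<bullet> a)" "0 \<le> (1 - u) * (f \<bullet> a - f \<bullet> b)"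
      using * by (simp_all add: inner_add_right algebra_simps)
    then show ?R using u by (auto simp: zero_le_mult_iff)
  next
    assume R: ?R
    have "f \<bullet> ((1 - w) *\<^sub>R a + w *\<^sub>R b) \<le> f \<bullet> ((1 - u) *\<^sub>R a + u *\<^sub>R b)"
      if w: "0 \<le> w" "w \<le> 1" for w
    proof -
      \<comment> \<open>This product is the difference of the values of \<open>f\<close> at the
        parameters \<open>u\<close> and \<open>w\<close>.\<close>
      have "0 \<le> (u - w) * (f \<bullet> b - f \<bullet> a)"
        using R u w by (cases "u = 0"; cases "u = 1") (auto simp: zero_le_mult_iff mult_le_0_iff)
      then show ?thesis by (simp add: inner_add_right algebra_simps)
    qed
    then show ?L using u by (auto simp: max_face_def in_segment)
  qed
  show ?thesis
  proof
    assume L: "max_face (closed_segment a b) c \<subseteq> max_face (closed_segment a b) d"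
    show "(c \<bullet> a \<le> c \<bullet> b \<longrightarrow> d \<bullet> a \<le> d \<bullet> b) \<and> (c \<bullet> b \<le> c \<bullet> a \<longrightarrow> d \<bullet> b \<le> d \<bullet> a)"
      using mem[of 0 c] mem[of 0 d] mem[of 1 c] mem[of 1 d] L by auto
  next
    assume R: "(c \<bullet> a \<le> c \<bullet> b \<longrightarrow> d \<bullet> a \<le> d \<bullet> b) \<and> (c \<bullet> b \<le> c \<bullet> a \<longrightarrow> d \<bullet> b \<le> d \<bullet> a)"
    show "max_face (closed_segment a b) c \<subseteq> max_face (closed_segment a b) d"
    proof
      fix x assume x: "x \<in> max_face (closed_segment a b) c"
      then obtain u where u: "0 \<le> u" "u \<le> 1" "x = (1 - u) *\<^sub>R a + u *\<^sub>R b"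
        by (auto simp: max_face_def in_segment)
      show "x \<in> max_face (closed_segment a b) d"
        using x mem[OF u(1,2), of c] mem[OF u(1,2), of d] R by (auto simp: u(3))
    qed
  qed
qed

text \<open>Faces of a polytope are exposed, and for a nonempty face the level of the exposing
  hyperplane is the maximum of the form. The polytope itself belongs to the zero form.\<close>

lemma nonempty_faces_polytope:
  fixes Z :: "'a::euclidean_space set"
  assumes "polytope Z" "Z \<noteq> {}"
  shows "{F. F face_of Z \<and> F \<noteq> {}} = range (max_face Z)"
proof (intro equalityI subsetI)
  fix F assume "F \<in> {F. F face_of Z \<and> F \<noteq> {}}"
  then have F: "F face_of Z" "F \<noteq> {}" by auto
  then have "F exposed_face_of Z"
    using assms exposed_face_of_polyhedron polytope_imp_polyhedron by blast
  then obtain a b where ab: "Z \<subseteq> {x. a \<bullet> x \<le> b}" "F = Z \<inter> {x. a \<bullet> x = b}"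
    unfolding exposed_face_of_def by auto
  obtain x where x: "x \<in> Z" "a \<bullet> x = b" using ab F by auto
  have "a \<bullet> y \<le> b" if "y \<in> Z" for y using ab(1) that by auto
  then have "F = max_face Z a"
    using x unfolding ab(2) max_face_def by (auto intro: order_antisym)
  then show "F \<in> range (max_face Z)" by simp
next
  fix F assume "F \<in> range (max_face Z)"
  then obtain c where c: "F = max_face Z c" by auto
  have ne: "F \<noteq> {}"
    unfolding c by (intro max_face_nonempty polytope_imp_compact assms)
  then obtain x where x: "x \<in> F" by auto
  then have "F = Z \<inter> {y. c \<bullet> y = c \<bullet> x}"
    unfolding c max_face_def by (auto intro: order_antisym)
  moreover have "(Z \<inter> {y. c \<bullet> y = c \<bullet> x}) face_of Z"
    using x c assms(1) by (intro face_of_Int_supporting_hyperplane_le polytope_imp_convex) (auto simp: max_face_def)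
  ultimately show "F \<in> {F. F face_of Z \<and> F \<noteq> {}}" using ne by simp
qed

text \<open>
  An orientation-free form of the sign vector of \<open>c\<close> with respect to the graphic arrangement of \<open>E\<close>.
\<close>

definition cmp_pairs :: "'a set set \<Rightarrow> ('a \<Rightarrow> real) \<Rightarrow> ('a \<times> 'a) set" where
  "cmp_pairs E c = {(i, j). {i, j} \<in> E \<and> c i \<le> c j}"

lemma graphical_zonotope_polytope:
  fixes E :: "'k::finite set set"
  assumes "\<And>e. e \<in> E \<Longrightarrow> e \<noteq> {}"
  shows "polytope (graphical_zonotope E)" "graphical_zonotope E \<noteq> {}"
proof -
  let ?A = "\<lambda>e::'k set. (\<lambda>i. axis i (1::real)) ` e :: (real^'k) set"
  have eq: "graphical_zonotope E = convex hull (\<Sum>e\<in>E. ?A e)"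
    by (simp add: graphical_zonotope_def convex_hull_set_sum)
  have "finite (\<Sum>e\<in>E. ?A e)"
    by (induct E rule: infinite_finite_induct) (simp_all add: finite_set_plus)
  then show "polytope (graphical_zonotope E)"
    unfolding eq polytope_def by blast
  have "\<exists>i. i \<in> e" if "e \<in> E" for e using assms that by blast
  then obtain f where f: "\<And>e. e \<in> E \<Longrightarrow> f e \<in> e" by metis
  have "(\<Sum>e\<in>E. axis (f e) 1) \<in> (\<Sum>e\<in>E. ?A e)"
    unfolding set_sum_alt[OF finite] using f by blast
  then show "graphical_zonotope E \<noteq> {}" unfolding eq by auto
qed

text \<open>Two functions with the same fibres have images of equal size. This carries the count
  from faces to states, and from states of a glued graph to pairs of states.\<close>

lemma card_image_cong_iff:
  assumes "\<And>x y. x \<in> A \<Longrightarrow> y \<in> A \<Longrightarrow> f x = f y \<longleftrightarrow> g x = g y"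
  shows "card (f ` A) = card (g ` A)"
proof (rule bij_betw_same_card)
  have "inv_into A f (f x) \<in> A" "f (inv_into A f (f x)) = f x" if "x \<in> A" for x
    using that by (simp_all add: inv_into_into f_inv_into_f)
  then have "g (inv_into A f (f x)) = g x" if "x \<in> A" for x using assms that by blast
  then show "bij_betw (\<lambda>y. g (inv_into A f y)) (f ` A) (g ` A)"
    by (simp add: bij_betw_def inj_on_def image_image assms)
qed

lemma num_faces_graphical_zonotope:
  fixes E :: "'k::finite set set"
  assumes E: "\<And>e. e \<in> E \<Longrightarrow> card e = 2"
  shows "num_faces (graphical_zonotope E) = card (range (cmp_pairs E))"
proof -
  let ?S = "\<lambda>e::'k set. convex hull ((\<lambda>i. axis i (1::real)) ` e) :: (real^'k) set"
  let ?Z = "graphical_zonotope E"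
  have ne: "\<And>e. e \<in> E \<Longrightarrow> e \<noteq> {}" using E by fastforce
  \<comment> \<open>Inclusions are compared first, since they can be tested segment by segment;
    equality of faces then follows by antisymmetry.\<close>
  have sub: "max_face ?Z c \<subseteq> max_face ?Z d \<longleftrightarrow> cmp_pairs E (($) c) \<subseteq> cmp_pairs E (($) d)" for c d
  proof -
    have "max_face ?Z c \<subseteq> max_face ?Z d \<longleftrightarrow> (\<forall>e\<in>E. max_face (?S e) c \<subseteq> max_face (?S e) d)"
      unfolding graphical_zonotope_def
      by (rule max_face_set_sum_subset_iff) (simp_all add: compact_convex_hull finite_imp_compact ne)
    also have "\<dots> \<longleftrightarrow> (\<forall>i j. {i, j} \<in> E \<longrightarrow> c $ i \<le> c $ j \<longrightarrow> d $ i \<le> d $ j)"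
    proof -
      have seg: "?S {i, j} = closed_segment (axis i 1) (axis j 1)" for i j
        by (simp add: segment_convex_hull)
      have *: "max_face (?S {i, j}) c \<subseteq> max_face (?S {i, j}) d \<longleftrightarrow>
          (c $ i \<le> c $ j \<longrightarrow> d $ i \<le> d $ j) \<and> (c $ j \<le> c $ i \<longrightarrow> d $ j \<le> d $ i)" for i j
        unfolding seg max_face_segment_subset_iff by (simp add: inner_axis)
      show ?thesis
      proof (intro iffI allI impI ballI)
        fix i j assume "\<forall>e\<in>E. max_face (?S e) c \<subseteq> max_face (?S e) d" "{i, j} \<in> E" "c $ i \<le> c $ j"
        then show "d $ i \<le> d $ j" using *[of i j] by blast
      next
        fix e assume H: "\<forall>i j. {i, j} \<in> E \<longrightarrow> c $ i \<le> c $ j \<longrightarrow> d $ i \<le> d $ j" and e: "e \<in> E"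
        obtain i j where "e = {i, j}" using E[OF e] by (auto simp: card_2_iff)
        then show "max_face (?S e) c \<subseteq> max_face (?S e) d"
          using *[of i j] H e by (metis insert_commute)
      qed
    qed
    also have "\<dots> \<longleftrightarrow> cmp_pairs E (($) c) \<subseteq> cmp_pairs E (($) d)"
      by (auto simp: cmp_pairs_def)
    finally show ?thesis .
  qed
  have "num_faces ?Z = card (range (max_face ?Z))"
    unfolding num_faces_def
    using nonempty_faces_polytope[OF graphical_zonotope_polytope[OF ne]] by simp
  also have "\<dots> = card (range (\<lambda>c :: real^'k. cmp_pairs E (($) c)))"
    by (rule card_image_cong_iff) (simp only: set_eq_subset sub)
  also have "range (\<lambda>c :: real^'k. cmp_pairs E (($) c)) = range (cmp_pairs E)"
  proof -
    have "cmp_pairs E f \<in> range (\<lambda>c :: real^'k. cmp_pairs E (($) c))" for f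
      by (rule image_eqI[of _ _ "\<chi> i. f i"]) (auto simp: cmp_pairs_def)
    then show ?thesis by auto
  qed
  finally show ?thesis .
qed

subsection \<open>Counting states\<close>

text \<open>
  Triangulations with a distinguished side \<open>i j\<close>, together with the number of triangles: removing the
  triangle on that side leaves two triangulations, possibly degenerated to a single edge.
\<close>

inductive triangle_tree :: "'a set set \<Rightarrow> 'a \<Rightarrow> 'a \<Rightarrow> nat \<Rightarrow> bool" where
  single: "i \<noteq> j \<Longrightarrow> triangle_tree {{i, j}} i j 0"
| glue: "triangle_tree E i k m \<Longrightarrow> triangle_tree F k j n \<Longrightarrow> \<Union>E \<inter> \<Union>F = {k} \<Longrightarrow>
    triangle_tree (insert {i, j} (E \<union> F)) i j (Suc (m + n))"

lemma triangle_tree_edges: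
  assumes "triangle_tree E i j n"
  shows "finite E" "\<forall>e\<in>E. card e = 2" "{i, j} \<in> E" "i \<noteq> j"
proof -
  have "finite E \<and> (\<forall>e\<in>E. card e = 2) \<and> {i, j} \<in> E \<and> i \<noteq> j"
    using assms
  proof (induction rule: triangle_tree.induct)
    case (glue E i k m F j n)
    have "i \<noteq> j"
    proof
      assume "i = j"
      then have "i \<in> \<Union>E \<inter> \<Union>F" using glue.IH by auto
      with glue show False by auto
    qed
    with glue.IH show ?case by auto
  qed auto
  then show "finite E" "\<forall>e\<in>E. card e = 2" "{i, j} \<in> E" "i \<noteq> j" by auto
qed

section \<open>States sorted by the sign on the distinguished side\<close>

definition states :: "'a set set \<Rightarrow> 'a \<Rightarrow> 'a \<Rightarrow> real \<Rightarrow> ('a \<times> 'a) set set" where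
  "states E i j s = cmp_pairs E ` {c. sgn (c j - c i) = s}"

lemma finite_cmp_pairs:
  assumes "finite E" "\<forall>e\<in>E. card e = 2"
  shows "finite (range (cmp_pairs E))"
proof (rule finite_subset)
  show "range (cmp_pairs E) \<subseteq> Pow (\<Union>E \<times> \<Union>E)"
    by (auto simp: cmp_pairs_def)
  have "finite e" if "e \<in> E" for e using assms(2) that by (intro card_ge_0_finite) simp
  then show "finite (Pow (\<Union>E \<times> \<Union>E))" using assms(1) by auto
qed

lemma finite_states:
  assumes "finite E" "\<forall>e\<in>E. card e = 2"
  shows "finite (states E i j s)"
  by (rule finite_subset[OF _ finite_cmp_pairs[OF assms]]) (auto simp: states_def)

lemma cmp_pairs_subset:
  assumes "E \<subseteq> F"
  shows "cmp_pairs E c = cmp_pairs F c \<inter> {(i, j). {i, j} \<in> E}"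
  using assms by (auto simp: cmp_pairs_def)

lemma cmp_pairs_insert_Un:
  "cmp_pairs (insert e (E \<union> F)) c = cmp_pairs {e} c \<union> cmp_pairs E c \<union> cmp_pairs F c"
  by (auto simp: cmp_pairs_def)

lemma cmp_pairs_sgn_eq:
  assumes "{i, j} \<in> E" "cmp_pairs E c = cmp_pairs E d"
  shows "sgn (c j - c i) = sgn (d j - d i)"
proof -
  have "(i, j) \<in> cmp_pairs E c \<longleftrightarrow> (i, j) \<in> cmp_pairs E d" "(j, i) \<in> cmp_pairs E c \<longleftrightarrow> (j, i) \<in> cmp_pairs E d"
    using assms(2) by auto
  then show ?thesis using assms(1) by (auto simp: cmp_pairs_def insert_commute sgn_if)
qed

lemma cmp_pairs_single:
  assumes "sgn (c j - c i) = sgn (d j - d i)"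
  shows "cmp_pairs {{i, j}} c = cmp_pairs {{i, j}} d"
proof -
  have "c i \<le> c j \<longleftrightarrow> d i \<le> d j" "c j \<le> c i \<longleftrightarrow> d j \<le> d i"
    using assms by (auto simp: sgn_if split: if_splits)
  then show ?thesis by (auto simp: cmp_pairs_def doubleton_eq_iff)
qed

lemma cmp_pairs_cong:
  assumes "\<And>u v. {u, v} \<in> E \<Longrightarrow> c u \<le> c v \<longleftrightarrow> d u \<le> d v"
  shows "cmp_pairs E c = cmp_pairs E d"
  using assms by (auto simp: cmp_pairs_def)

lemma states_disjoint:
  assumes "{i, j} \<in> E" "s \<noteq> t"
  shows "states E i j s \<inter> states E i j t = {}"
proof (rule equals0I)
  fix x assume "x \<in> states E i j s \<inter> states E i j t"
  then obtain c d where "x = cmp_pairs E c" "sgn (c j - c i) = s" "x = cmp_pairs E d" "sgn (d j - d i) = t"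
    unfolding states_def by blast
  then show False using cmp_pairs_sgn_eq[OF assms(1), of c d] assms(2) by simp
qed

text \<open>Negating \<open>c\<close> turns its state into the converse relation and flips the
  sign.\<close>

lemma card_states_uminus: "card (states E i j (- s)) = card (states E i j s)"
proof -
  have "cmp_pairs E (\<lambda>u. - c u) = (cmp_pairs E c)\<inverse>" for c :: "'a \<Rightarrow> real"
  proof -
    have "{v, u} \<in> E \<longleftrightarrow> {u, v} \<in> E" for u v by (simp add: insert_commute)
    then show ?thesis by (simp add: cmp_pairs_def set_eq_iff)
  qed
  moreover have "{c. sgn (c j - c i) = - s} = (\<lambda>c u. - c u) ` {c :: 'a \<Rightarrow> real. sgn (c j - c i) = s}"
  proof (intro equalityI subsetI)
    fix c :: "'a \<Rightarrow> real" assume "c \<in> {c. sgn (c j - c i) = - s}"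
    then have "sgn (- (c j - c i)) = s" unfolding sgn_minus by simp
    then show "c \<in> (\<lambda>c u. - c u) ` {c :: 'a \<Rightarrow> real. sgn (c j - c i) = s}"
      by (intro image_eqI[of _ _ "\<lambda>u. - c u"]) auto
  next
    fix c :: "'a \<Rightarrow> real" assume "c \<in> (\<lambda>c u. - c u) ` {c :: 'a \<Rightarrow> real. sgn (c j - c i) = s}"
    then obtain d where d: "c = (\<lambda>u. - d u)" "sgn (d j - d i) = s" by auto
    then have "c j - c i = - (d j - d i)" by simp
    then show "c \<in> {c. sgn (c j - c i) = - s}" using d(2) by (simp only: sgn_minus mem_Collect_eq)
  qed
  ultimately have "states E i j (- s) = converse ` states E i j s"
    by (simp add: states_def image_image)
  moreover have "inj_on converse (states E i j s)" by (rule inj_onI) simp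
  ultimately show ?thesis by (simp add: card_image)
qed

section \<open>Gluing two graphs along a triangle\<close>

lemma sgn_eq_imp_scale:
  fixes x y :: real
  assumes "sgn x = sgn y"
  obtains l where "l > 0" "l * x = y"
proof (cases "x = 0")
  case True
  then show ?thesis using assms that[of 1] by (simp add: sgn_zero_iff)
next
  case False
  then have "y / x > 0" using assms by (auto simp: sgn_if zero_less_divide_iff split: if_splits)
  then show ?thesis using that[of "y / x"] False by simp
qed

text \<open>With \<open>x = c k - c i\<close> and \<open>y = c j - c k\<close> these are the
  possible signs on the sides \<open>i k\<close> and \<open>k j\<close> of a triangle whose side
  \<open>i j\<close> has sign \<open>s\<close>.\<close>

definition sgn_sums :: "real \<Rightarrow> (real \<times> real) set" where
  "sgn_sums s = {(sgn x, sgn y) | x y. sgn (x + y) = s}"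

lemma sgn_sums_0: "sgn_sums 0 = {(0, 0), (1, - 1), (- 1, 1)}"
proof (intro equalityI subsetI)
  fix p assume "p \<in> sgn_sums 0"
  then show "p \<in> {(0, 0), (1, - 1), (- 1, 1)}" by (auto simp: sgn_sums_def sgn_if split: if_splits)
next
  have "(sgn x, sgn (- x)) \<in> sgn_sums 0" for x
    unfolding sgn_sums_def by (intro CollectI exI[of _ x] exI[of _ "- x"]) simp
  from this[of 0] this[of 1] this[of "-1"]
  show "p \<in> sgn_sums 0" if "p \<in> {(0, 0), (1, - 1), (- 1, 1)}" for p using that by auto
qed

lemma sgn_sums_1: "sgn_sums 1 = {(0, 1), (1, 0), (1, 1), (1, - 1), (- 1, 1)}"
proof (intro equalityI subsetI)
  fix p assume "p \<in> sgn_sums 1"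
  then show "p \<in> {(0, 1), (1, 0), (1, 1), (1, - 1), (- 1, 1)}" by (auto simp: sgn_sums_def sgn_if split: if_splits)
next
  have *: "(sgn x, sgn y) \<in> sgn_sums 1" if "x + y > 0" for x y using that unfolding sgn_sums_def by force
  show "p \<in> sgn_sums 1" if "p \<in> {(0, 1), (1, 0), (1, 1), (1, - 1), (- 1, 1)}" for p
    using that *[of 0 1] *[of 1 0] *[of 1 1] *[of 2 "-1"] *[of "-1" 2] by auto
qed

text \<open>
  Two functions on the two parts are glued by translating both to vanish at \<open>k\<close>; scaling them by positive
  factors does not change their states and realises every admissible sign of \<open>c j - c i\<close>.
\<close>

lemma glue_states_image:
  assumes "\<Union>E \<inter> \<Union>F = {k}" "i \<in> \<Union>E" "j \<in> \<Union>F"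
  shows "(\<lambda>c. (cmp_pairs E c, cmp_pairs F c)) ` {c. sgn (c j - c i) = s}
    = (\<Union>(s1, s2)\<in>sgn_sums s. states E i k s1 \<times> states F k j s2)" (is "?L = ?R")
proof (intro equalityI subsetI)
  fix p assume "p \<in> ?L"
  then obtain c where c: "sgn (c j - c i) = s" "p = (cmp_pairs E c, cmp_pairs F c)" by auto
  have "(sgn (c k - c i), sgn (c j - c k)) \<in> sgn_sums s"
    unfolding sgn_sums_def using c(1) by (intro CollectI exI[of _ "c k - c i"] exI[of _ "c j - c k"]) simp
  then show "p \<in> ?R" unfolding c(2) states_def by force
next
  fix p assume "p \<in> ?R"
  then obtain c d x y where p: "p = (cmp_pairs E c, cmp_pairs F d)" "sgn (c k - c i) = sgn x"
      "sgn (d j - d k) = sgn y" "sgn (x + y) = s"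
    unfolding states_def sgn_sums_def by auto
  obtain l where l: "l > 0" "l * (c k - c i) = x" using sgn_eq_imp_scale p(2) by blast
  obtain r where r: "r > 0" "r * (d j - d k) = y" using sgn_eq_imp_scale p(3) by blast
  define h where "h u = (if u \<in> \<Union>E then l * (c u - c k) else r * (d u - d k))" for u
  have hE: "h u = l * (c u - c k)" if "u \<in> \<Union>E" for u using that by (simp add: h_def)
  have hF: "h u = r * (d u - d k)" if "u \<in> \<Union>F" for u
  proof (cases "u \<in> \<Union>E")
    case True
    then have "u = k" using that assms(1) by blast
    then show ?thesis by (simp add: h_def)
  qed (simp add: h_def)
  have "cmp_pairs E h = cmp_pairs E c"
    by (rule cmp_pairs_cong) (subst (1 2) hE; use l(1) in auto)
  moreover have "cmp_pairs F h = cmp_pairs F d"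
    by (rule cmp_pairs_cong) (subst (1 2) hF; use r(1) in auto)
  moreover have "h j - h i = x + y"
    unfolding hE[OF assms(2)] hF[OF assms(3)] using l(2) r(2) by (simp add: algebra_simps)
  ultimately show "p \<in> ?L" using p(1,4) by (intro image_eqI[of _ _ h]) simp_all
qed

text \<open>Once the sign on \<open>i j\<close> is fixed, that edge carries no further information,
  so a state amounts to a pair of states on the two parts. These pairs are sorted disjointly by
  their own signs.\<close>

lemma card_states_glue:
  assumes E: "finite E" "\<forall>e\<in>E. card e = 2" "{i, k} \<in> E"
    and F: "finite F" "\<forall>e\<in>F. card e = 2" "{k, j} \<in> F"
    and EF: "\<Union>E \<inter> \<Union>F = {k}" and fin: "finite (sgn_sums s)"
  shows "card (states (insert {i, j} (E \<union> F)) i j s)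
    = (\<Sum>(s1, s2)\<in>sgn_sums s. card (states E i k s1) * card (states F k j s2))"
proof -
  let ?G = "insert {i, j} (E \<union> F)"
  have "card (states ?G i j s) = card ((\<lambda>c. (cmp_pairs E c, cmp_pairs F c)) ` {c. sgn (c j - c i) = s})"
    unfolding states_def
  proof (rule card_image_cong_iff)
    fix c d :: "'a \<Rightarrow> real" assume cd: "c \<in> {c. sgn (c j - c i) = s}" "d \<in> {c. sgn (c j - c i) = s}"
    then have "cmp_pairs {{i, j}} c = cmp_pairs {{i, j}} d" by (intro cmp_pairs_single) simp
    then show "cmp_pairs ?G c = cmp_pairs ?G d \<longleftrightarrow>
        (cmp_pairs E c, cmp_pairs F c) = (cmp_pairs E d, cmp_pairs F d)"
      using cmp_pairs_subset[of E ?G] cmp_pairs_subset[of F ?G]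
      by (metis Pair_inject cmp_pairs_insert_Un subset_insertI2 sup_ge1 sup_ge2)
  qed
  also have "\<dots> = card (\<Union>(s1, s2)\<in>sgn_sums s. states E i k s1 \<times> states F k j s2)"
    by (subst glue_states_image) (use E F EF in auto)
  also have "\<dots> = (\<Sum>p\<in>sgn_sums s. card (case p of (s1, s2) \<Rightarrow> states E i k s1 \<times> states F k j s2))"
  proof (rule card_UN_disjoint[OF fin])
    show "\<forall>p\<in>sgn_sums s. finite (case p of (s1, s2) \<Rightarrow> states E i k s1 \<times> states F k j s2)"
      using finite_states[OF E(1,2)] finite_states[OF F(1,2)] by (auto simp: split_beta)
    show "\<forall>p\<in>sgn_sums s. \<forall>q\<in>sgn_sums s. p \<noteq> q \<longrightarrow>
        (case p of (s1, s2) \<Rightarrow> states E i k s1 \<times> states F k j s2) \<inter>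
        (case q of (s1, s2) \<Rightarrow> states E i k s1 \<times> states F k j s2) = {}"
    proof (intro ballI impI)
      fix p q :: "real \<times> real" assume "p \<noteq> q"
      then have "fst p \<noteq> fst q \<or> snd p \<noteq> snd q" by (simp add: prod_eq_iff)
      then show "(case p of (s1, s2) \<Rightarrow> states E i k s1 \<times> states F k j s2) \<inter>
        (case q of (s1, s2) \<Rightarrow> states E i k s1 \<times> states F k j s2) = {}"
        using states_disjoint[OF E(3), of "fst p" "fst q"] states_disjoint[OF F(3), of "snd p" "snd q"]
        by (auto simp: split_beta)
    qed
  qed
  finally show ?thesis by (simp add: split_beta card_cartesian_product)
qed

text \<open>The product of \<open>a + b x\<close> and \<open>a' + b' x\<close> reduced by
  \<open>x^2 = 3 x + 2\<close>. The coefficients 2 and 3 of \<open>b * b'\<close> count the pairs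
  without a zero in \<open>sgn_sums 0\<close> and \<open>sgn_sums 1\<close>.\<close>

lemma state_count_glue:
  "state_count (Suc (m + n)) = (case state_count m of (a, b) \<Rightarrow> case state_count n of (a', b') \<Rightarrow>
     (a * a' + 2 * (b * b'), a * b' + b * a' + 3 * (b * b')))"
  by (induction m) (auto simp: algebra_simps split: prod.splits)

lemma triangle_tree_states:
  assumes "triangle_tree E i j n"
  shows "state_count n = (card (states E i j 0), card (states E i j 1))"
  using assms
proof (induction rule: triangle_tree.induct)
  case (single i j)
  \<comment> \<open>A single edge has one state per sign; the function with value \<open>s\<close>
    at \<open>j\<close> and zero elsewhere represents it.\<close>
  have "states {{i, j}} i j s = {cmp_pairs {{i, j}} (\<lambda>u. if u = j then s else 0)}" if "sgn s = s" for s
  proof -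
    have "cmp_pairs {{i, j}} c = cmp_pairs {{i, j}} (\<lambda>u. if u = j then s else 0)" if "sgn (c j - c i) = s" for c
      using that single \<open>sgn s = s\<close> by (intro cmp_pairs_single) simp
    moreover have "(\<lambda>u. if u = j then s else 0) \<in> {c. sgn (c j - c i) = s}"
      using that single by simp
    ultimately show ?thesis unfolding states_def by blast
  qed
  then show ?case by simp
next
  case (glue E i k m F j n)
  note E = triangle_tree_edges[OF glue.hyps(1)] and F = triangle_tree_edges[OF glue.hyps(2)]
  have *: "card (states (insert {i, j} (E \<union> F)) i j s)
    = (\<Sum>(s1, s2)\<in>sgn_sums s. card (states E i k s1) * card (states F k j s2))" if "finite (sgn_sums s)" for s
    using card_states_glue[OF E(1-3) F(1-3) glue.hyps(3) that] .
  have neg: "card (states G u v (-1)) = card (states G u v 1)" for G and u v :: 'a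
    using card_states_uminus[of G u v 1] .
  show ?case
    unfolding state_count_glue glue.IH by (simp add: * sgn_sums_0 sgn_sums_1 neg)
qed

lemma card_range_cmp_pairs_triangle_tree:
  assumes "triangle_tree E i j n"
  shows "card (range (cmp_pairs E)) = fst (state_count n) + 2 * snd (state_count n)"
proof -
  note E = triangle_tree_edges[OF assms]
  have "c \<in> {c. sgn (c j - c i) = 0} \<union> {c. sgn (c j - c i) = 1} \<union> {c. sgn (c j - c i) = -1}"
    for c :: "'a \<Rightarrow> real" by (auto simp: sgn_if)
  then have "range (cmp_pairs E) = states E i j 0 \<union> states E i j 1 \<union> states E i j (-1)"
    unfolding states_def by blast
  also have "card \<dots> = card (states E i j 0) + card (states E i j 1) + card (states E i j (-1))"
    using states_disjoint[OF E(3), of 0 1] states_disjoint[OF E(3), of 0 "-1"] states_disjoint[OF E(3), of 1 "-1"]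
      finite_states[OF E(1,2)]
    by (subst card_Un_disjoint; simp add: Int_Un_distrib2)+
  finally show ?thesis
    using triangle_tree_states[OF assms] card_states_uminus[of E i j 1] by simp
qed

subsection \<open>Triangulated convex polygons\<close>

text \<open>Twice the signed area of the triangle \<open>p q r\<close>, positive for
  counterclockwise order.\<close>

definition orient :: "real^2 \<Rightarrow> real^2 \<Rightarrow> real^2 \<Rightarrow> real" where
  "orient p q r = (q $ 1 - p $ 1) * (r $ 2 - p $ 2) - (q $ 2 - p $ 2) * (r $ 1 - p $ 1)"

lemma orient_rotate: "orient q r p = orient p q r"
  by (simp add: orient_def algebra_simps)

lemma orient_swap: "orient q p r = - orient p q r"
  by (simp add: orient_def algebra_simps)

lemma orient_same [simp]: "orient p p r = 0" "orient p q p = 0" "orient p q q = 0"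
  by (simp_all add: orient_def)

lemma orient_sum: "orient p q x + orient q r x + orient r p x = orient p q r"
  by (simp add: orient_def algebra_simps)

lemma orient_affine:
  assumes "a + b + c = 1"
  shows "orient p q (a *\<^sub>R x + b *\<^sub>R y + c *\<^sub>R z) = a * orient p q x + b * orient p q y + c * orient p q z"
proof -
  have a: "a = 1 - b - c" using assms by simp
  show ?thesis unfolding a by (simp add: orient_def algebra_simps)
qed

text \<open>Cramer's rule for barycentric coordinates, cleared of denominators so that it can be
  solved for a corner as well as for \<open>x\<close>.\<close>

lemma orient_barycentric:
  "orient p q r *\<^sub>R x = orient q r x *\<^sub>R p + orient r p x *\<^sub>R q + orient p q x *\<^sub>R r"
  by (simp add: vec_eq_iff forall_2 orient_def algebra_simps)

lemma orient_eq_0_imp: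
  assumes "orient p q r = 0" "p \<noteq> q"
  obtains t where "r = p + t *\<^sub>R (q - p)"
proof -
  obtain t where "t * (q $ 1 - p $ 1) = r $ 1 - p $ 1" "t * (q $ 2 - p $ 2) = r $ 2 - p $ 2"
  proof (cases "q $ 1 = p $ 1")
    case True
    then have "q $ 2 \<noteq> p $ 2" using assms(2) by (auto simp: vec_eq_iff forall_2)
    with True assms(1) that[of "(r $ 2 - p $ 2) / (q $ 2 - p $ 2)"] show ?thesis
      by (simp add: orient_def)
  next
    case False
    with assms(1) that[of "(r $ 1 - p $ 1) / (q $ 1 - p $ 1)"] show ?thesis
      by (simp add: orient_def field_simps)
  qed
  then have "r = p + t *\<^sub>R (q - p)" by (simp add: vec_eq_iff forall_2)
  then show ?thesis by (rule that)
qed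

lemma in_convex_hull_2I:
  assumes "0 \<le> u" "u \<le> 1" "x = (1 - u) *\<^sub>R a + u *\<^sub>R b"
  shows "x \<in> convex hull {a, b}"
  using assms by (auto simp: segment_convex_hull[symmetric] in_segment)

lemma in_convex_hull_3I:
  assumes "0 < d" "0 \<le> \<alpha>" "0 \<le> \<beta>" "0 \<le> \<gamma>" "\<alpha> + \<beta> + \<gamma> = d"
    and "d *\<^sub>R x = \<alpha> *\<^sub>R a + \<beta> *\<^sub>R b + \<gamma> *\<^sub>R c"
  shows "x \<in> convex hull {a, b, c}"
proof -
  have "x = (1 / d) *\<^sub>R (d *\<^sub>R x)" using assms(1) by simp
  also have "\<dots> = (\<alpha> / d) *\<^sub>R a + (\<beta> / d) *\<^sub>R b + (\<gamma> / d) *\<^sub>R c"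
    unfolding assms(6) by (simp add: scaleR_add_right)
  finally have "x = (\<alpha> / d) *\<^sub>R a + (\<beta> / d) *\<^sub>R b + (\<gamma> / d) *\<^sub>R c" .
  moreover have "\<alpha> / d + \<beta> / d + \<gamma> / d = 1"
    using assms(1,5) by (simp add: add_divide_distrib[symmetric])
  moreover have "0 \<le> \<alpha> / d" "0 \<le> \<beta> / d" "0 \<le> \<gamma> / d" using assms(1-4) by simp_all
  ultimately show ?thesis unfolding convex_hull_3 by blast
qed

text \<open>Of three points on a line one lies between the other two, which is impossible for
  distinct extreme points.\<close>

lemma on_line_cases:
  fixes p q r :: "'a::real_vector"
  assumes "r = p + t *\<^sub>R (q - p)"
  shows "t < 0 \<and> p \<in> convex hull {r, q} \<or> 0 \<le> t \<and> t \<le> 1 \<and> r \<in> convex hull {p, q} \<or> 1 < t \<and> q \<in> convex hull {p, r}"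
proof -
  have r: "r = (1 - t) *\<^sub>R p + t *\<^sub>R q"
    unfolding assms scaleR_diff_left scaleR_diff_right by simp
  consider "t < 0" | "0 \<le> t" "t \<le> 1" | "1 < t" by linarith
  then show ?thesis
  proof cases
    case 1
    define w where "w = - t / (1 - t)"
    have w: "1 - w = 1 / (1 - t)" using 1 by (simp add: w_def field_simps)
    have "(1 - w) *\<^sub>R r = p + (t / (1 - t)) *\<^sub>R q"
      unfolding w r scaleR_add_right scaleR_scaleR using 1 by simp
    then have "p = (1 - w) *\<^sub>R r + w *\<^sub>R q" by (simp add: w_def)
    moreover have "0 \<le> w" "w \<le> 1" using 1 by (simp_all add: w_def field_simps)
    ultimately have "p \<in> convex hull {r, q}" by (intro in_convex_hull_2I)
    then show ?thesis using 1 by blast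
  next
    case 2
    then have "r \<in> convex hull {p, q}" using r by (rule in_convex_hull_2I)
    then show ?thesis using 2 by blast
  next
    case 3
    have "(1 / t) *\<^sub>R r = (1 / t) *\<^sub>R p + (q - p)" using 3 by (simp add: assms scaleR_add_right)
    then have "q = (1 - 1 / t) *\<^sub>R p + (1 / t) *\<^sub>R r" by (simp add: scaleR_diff_left)
    moreover have "0 \<le> 1 / t" "1 / t \<le> 1" using 3 by simp_all
    ultimately have "q \<in> convex hull {p, r}" by (intro in_convex_hull_2I)
    then show ?thesis using 3 by blast
  qed
qed

section \<open>Vertices in convex position\<close>

locale triangulated_polygon =
  fixes P :: "(real^2) set" and \<T> :: "(real^2) set set" and v :: "'k::finite \<Rightarrow> real^2"
  assumes polytope_P: "polytope P"
    and bij_v: "bij_betw v UNIV {x. x extreme_point_of P}"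
    and tri: "polygon_triangulation P \<T>"
begin

lemma v_eq_iff [simp]: "v i = v j \<longleftrightarrow> i = j"
  using bij_v by (auto simp: bij_betw_def inj_def)

lemma extreme_v: "v i extreme_point_of P"
  using bij_v by (auto simp: bij_betw_def)

lemma v_in_P: "v i \<in> P"
  using extreme_v by (simp add: extreme_point_of_def)

lemma convex_P: "convex P"
  using polytope_P by (rule polytope_imp_convex)

text \<open>An extreme point of \<open>P\<close> stays extreme in every convex subset containing it,
  and extreme points of a hull are among its generators. All uses of convex position rest on
  this.\<close>

lemma in_hull_imp_in:
  assumes "v i \<in> convex hull S" "S \<subseteq> P"
  shows "v i \<in> S"
proof -
  have "convex hull S \<subseteq> P" using assms(2) convex_P by (simp add: hull_minimal)
  then have "v i extreme_point_of convex hull S"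
    using extreme_v[of i] assms(1) by (auto simp: extreme_point_of_def)
  then show ?thesis by (rule extreme_point_of_convex_hull)
qed

lemma v_in_hull_iff: "v i \<in> convex hull (v ` K) \<longleftrightarrow> i \<in> K"
proof
  assume "v i \<in> convex hull (v ` K)"
  then have "v i \<in> v ` K" by (rule in_hull_imp_in) (auto simp: v_in_P)
  then show "i \<in> K" by auto
qed (simp add: hull_inc)

lemma v_in_hull_2_iff: "v i \<in> convex hull {v a, v b} \<longleftrightarrow> i \<in> {a, b}"
  using v_in_hull_iff[of i "{a, b}"] by simp

lemma v_in_hull_3_iff: "v i \<in> convex hull {v a, v b, v c} \<longleftrightarrow> i \<in> {a, b, c}"
  using v_in_hull_iff[of i "{a, b, c}"] by simp

definition ori :: "'k \<Rightarrow> 'k \<Rightarrow> 'k \<Rightarrow> real" where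
  "ori i j k = orient (v i) (v j) (v k)"

text \<open>No three distinct vertices are collinear, as one would lie between the others.\<close>

lemma ori_eq_0_iff: "ori i j k = 0 \<longleftrightarrow> i = j \<or> i = k \<or> j = k"
proof
  assume 0: "ori i j k = 0"
  show "i = j \<or> i = k \<or> j = k"
  proof (rule ccontr)
    assume ne: "\<not> (i = j \<or> i = k \<or> j = k)"
    then obtain t where "v k = v i + t *\<^sub>R (v j - v i)"
      using 0 orient_eq_0_imp[of "v i" "v j" "v k"] by (auto simp: ori_def)
    from on_line_cases[OF this] show False using ne by (auto simp: v_in_hull_2_iff)
  qed
qed (auto simp: ori_def)

lemma ori_rotate: "ori j k i = ori i j k"
  unfolding ori_def by (rule orient_rotate)

lemma ori_swap: "ori j i k = - ori i j k"
  unfolding ori_def by (rule orient_swap)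

lemma ori_sum: "ori i j u + ori j k u + ori k i u = ori i j k"
  by (simp add: ori_def orient_sum)

text \<open>Beyond both sides that meet at \<open>i\<close>, the barycentric identity solved for
  \<open>v i\<close> makes it a convex combination of \<open>v u\<close>, \<open>v j\<close>,
  \<open>v k\<close>.\<close>

lemma not_beyond_two_sides:
  assumes "ori i j k > 0" "ori i j u < 0" "ori k i u < 0" "u \<noteq> i"
  shows False
proof -
  let ?f1 = "ori i j u" and ?f2 = "ori j k u" and ?f3 = "ori k i u"
  have f2: "?f2 > 0" using ori_sum[of i j u k] assms by linarith
  have eq: "?f2 *\<^sub>R v i = ori i j k *\<^sub>R v u + (- ?f3) *\<^sub>R v j + (- ?f1) *\<^sub>R v k"
    using orient_barycentric[of "v i" "v j" "v k" "v u"] by (simp add: ori_def algebra_simps)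
  have "v i \<in> convex hull {v u, v j, v k}"
    by (rule in_convex_hull_3I[OF f2 _ _ _ _ eq]) (use assms ori_sum[of i j u k] in simp_all)
  then have "i \<in> {u, j, k}" by (simp only: v_in_hull_3_iff)
  then have "ori i j k = 0" using assms(4) by (auto simp: ori_eq_0_iff)
  with assms(1) show False by simp
qed

text \<open>Otherwise all barycentric coordinates are nonnegative and \<open>v u\<close> lies in the
  triangle.\<close>

lemma beyond_some_side:
  assumes "ori i j k > 0" "u \<notin> {i, j, k}"
  shows "ori i j u < 0 \<or> ori j k u < 0 \<or> ori k i u < 0"
proof (rule ccontr)
  let ?D = "ori i j k"
  assume n: "\<not> ?thesis"
  have eq: "?D *\<^sub>R v u = ori j k u *\<^sub>R v i + ori k i u *\<^sub>R v j + ori i j u *\<^sub>R v k"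
    using orient_barycentric[of "v i" "v j" "v k" "v u"] by (simp add: ori_def)
  have "v u \<in> convex hull {v i, v j, v k}"
    by (rule in_convex_hull_3I[OF assms(1) _ _ _ _ eq]) (use n ori_sum[of i j u k] in simp_all)
  then have "u \<in> {i, j, k}" by (simp only: v_in_hull_3_iff)
  with assms(2) show False by simp
qed

definition left :: "'k \<Rightarrow> 'k \<Rightarrow> 'k set" where
  "left i j = {u. ori i j u > 0}"

text \<open>
  In convex position every further vertex lies beyond exactly one side of the triangle \<open>i j k\<close>.
\<close>

lemma left_split:
  assumes k: "k \<in> left i j"
  shows "left i j = insert k (left i k \<union> left k j)"
    and "insert i (insert k (left i k)) \<inter> insert k (insert j (left k j)) = {k}"
    and "u \<in> left i k \<Longrightarrow> w \<in> insert j (left k j) \<Longrightarrow> ori i k w < 0"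
    and "u \<in> left k j \<Longrightarrow> w \<in> insert i (left i k) \<Longrightarrow> ori k j w < 0"
    and "k \<notin> left i k" "k \<notin> left k j" "left i k \<inter> left k j = {}"
proof -
  have D: "ori i j k > 0" using k by (simp add: left_def)
  have D': "ori j k i > 0" "ori k i j > 0" using D by (simp_all add: ori_rotate)
  have z: "ori a a b = 0" "ori a b a = 0" "ori a b b = 0" for a b by (simp_all add: ori_eq_0_iff)
  have ne: "i \<noteq> j" "i \<noteq> k" "j \<noteq> k" using D z by auto
  have s: "ori i k u = - ori k i u" "ori k j u = - ori j k u" for u
    by (simp_all add: ori_swap[of i k] ori_swap[of k j])
  have one: "ori i j u > 0 \<longleftrightarrow> ori k i u < 0 \<or> ori j k u < 0" "\<not> (ori k i u < 0 \<and> ori j k u < 0)"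
    "ori i j u \<noteq> 0" "ori j k u \<noteq> 0" "ori k i u \<noteq> 0" if u: "u \<notin> {i, j, k}" for u
  proof -
    show n: "ori i j u \<noteq> 0" "ori j k u \<noteq> 0" "ori k i u \<noteq> 0" using u ne by (auto simp: ori_eq_0_iff)
    \<comment> \<open>The corners \<open>i\<close>, \<open>j\<close> and \<open>k\<close> in turn,
      by rotating the triangle.\<close>
    have "ori i j u < 0 \<Longrightarrow> ori k i u < 0 \<Longrightarrow> False" using not_beyond_two_sides[OF D] u by auto
    moreover have "ori j k u < 0 \<Longrightarrow> ori i j u < 0 \<Longrightarrow> False" using not_beyond_two_sides[OF D'(1)] u by auto
    moreover have kk: "ori k i u < 0 \<Longrightarrow> ori j k u < 0 \<Longrightarrow> False" using not_beyond_two_sides[OF D'(2)] u by auto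
    moreover note beyond_some_side[OF D u] n
    ultimately show "ori i j u > 0 \<longleftrightarrow> ori k i u < 0 \<or> ori j k u < 0"
      by (metis less_asym neqE)
    show "\<not> (ori k i u < 0 \<and> ori j k u < 0)" using kk by blast
  qed
  have corner: "ori k i i = 0" "ori k i k = 0" "ori j k j = 0" "ori j k k = 0" "ori i j i = 0" "ori i j j = 0"
    by (simp_all add: z)
  show eq: "left i j = insert k (left i k \<union> left k j)"
  proof (rule set_eqI)
    fix u
    show "u \<in> left i j \<longleftrightarrow> u \<in> insert k (left i k \<union> left k j)"
      by (cases "u \<in> {i, j, k}") (use one(1)[of u] D D' corner in \<open>auto simp: left_def s\<close>)
  qed
  show disj: "left i k \<inter> left k j = {}"
  proof (rule equals0I)
    fix u assume "u \<in> left i k \<inter> left k j"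
    then have "ori k i u < 0" "ori j k u < 0" by (simp_all add: left_def s)
    then show False using one(2)[of u] D' corner by (cases "u \<in> {i, j, k}") auto
  qed
  show k1: "k \<notin> left i k" and k2: "k \<notin> left k j" using z by (auto simp: left_def)
  have "j \<notin> left i k" "i \<notin> left k j" using D' by (auto simp: left_def s)
  moreover have "i \<notin> left i k" "j \<notin> left k j" using z by (auto simp: left_def)
  ultimately show "insert i (insert k (left i k)) \<inter> insert k (insert j (left k j)) = {k}"
    using disj k1 k2 ne by auto
  show "ori i k w < 0" if "w \<in> insert j (left k j)" for w
  proof (cases "w = j")
    case False
    then have w: "w \<in> left k j" using that by simp
    then have "w \<notin> {i, j, k}" using \<open>i \<notin> left k j\<close> \<open>j \<notin> left k j\<close> k2 by auto
    then show ?thesis using one(2,5)[of w] w by (auto simp: left_def s)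
  qed (use D' s in simp)
  show "ori k j w < 0" if "w \<in> insert i (left i k)" for w
  proof (cases "w = i")
    case False
    then have w: "w \<in> left i k" using that by simp
    then have "w \<notin> {i, j, k}" using \<open>i \<notin> left i k\<close> \<open>j \<notin> left i k\<close> k1 by auto
    then show ?thesis using one(2,4)[of w] w by (auto simp: left_def s)
  qed (use D' s in simp)
qed

text \<open>
  The crossing point of the line through \<open>v i\<close>, \<open>v k\<close> with the segment from \<open>v u\<close> to \<open>v w\<close> lies between
  \<open>v i\<close> and \<open>v k\<close>, since otherwise one of these would not be extreme.
\<close>

lemma segments_cross:
  assumes u: "ori i k u > 0" and w: "ori i k w < 0"
  obtains q where "q \<in> open_segment (v i) (v k)" "q \<in> open_segment (v u) (v w)"
proof -
  \<comment> \<open>The zero of the affine function \<open>orient (v i) (v k)\<close> along the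
    segment from \<open>v u\<close> to \<open>v w\<close>.\<close>
  define s where "s = ori i k u / (ori i k u - ori i k w)"
  define q where "q = (1 - s) *\<^sub>R v u + s *\<^sub>R v w"
  have s: "0 < s" "s < 1" using u w by (auto simp: s_def field_simps)
  have uw: "u \<noteq> w" using u w by auto
  have ik: "i \<noteq> k" using u by (auto simp: ori_def)
  have qin: "q \<in> open_segment (v u) (v w)"
    unfolding in_segment q_def using s uw by auto
  have qh: "q \<in> convex hull {v u, v w}" by (rule in_convex_hull_2I[of s]) (use s q_def in auto)
  then have qP: "q \<in> P" using hull_minimal[of "{v u, v w}" P convex] v_in_P convex_P by auto
  have "orient (v i) (v k) q = (1 - s) * ori i k u + s * ori i k w"
    using orient_affine[of "1 - s" s 0 "v i" "v k" "v u" "v w" 0] by (simp add: q_def ori_def)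
  also have "\<dots> = ori i k u - s * (ori i k u - ori i k w)" by (simp add: algebra_simps)
  also have "\<dots> = 0" using u w by (simp add: s_def)
  finally obtain t where t: "q = v i + t *\<^sub>R (v k - v i)"
    using ik orient_eq_0_imp[of "v i" "v k" q] by auto
  \<comment> \<open>By extremality such a \<open>v l\<close> equals \<open>q\<close>, hence lies on
    the segment from \<open>v u\<close> to \<open>v w\<close> and is one of its ends.\<close>
  have notv: "l \<in> {u, w}" if "v l \<in> convex hull {q, v m}" "l \<noteq> m" for l m
  proof -
    have "v l \<in> {q, v m}" using that(1) by (rule in_hull_imp_in) (simp add: qP v_in_P)
    then have "v l \<in> convex hull {v u, v w}" using qh that by auto
    then show ?thesis by (simp only: v_in_hull_2_iff)
  qed
  have niw: "i \<notin> {u, w}" "k \<notin> {u, w}" using u w by (auto simp: ori_def)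
  have "t \<noteq> 0" using notv[of i k] niw ik t by (auto simp: hull_inc)
  moreover have "t \<noteq> 1" using notv[of k i] niw ik t by (auto simp: hull_inc)
  moreover have "\<not> t < 0" using on_line_cases[OF t] notv[of i k] niw ik by auto
  moreover have "\<not> 1 < t" using on_line_cases[OF t] notv[of k i] niw ik by (auto simp: insert_commute)
  ultimately have "0 < t" "t < 1" by auto
  then have "q \<in> open_segment (v i) (v k)"
    unfolding in_segment using ik t by (auto simp: algebra_simps intro!: exI[of _ t])
  with qin that show ?thesis by blast
qed

section \<open>Adjacency in the triangulation and recursive decomposition\<close>

definition adj :: "'k \<Rightarrow> 'k \<Rightarrow> bool" where
  "adj i j \<longleftrightarrow> i \<noteq> j \<and> (\<exists>T\<in>\<T>. v i \<in> T \<and> v j \<in> T)"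

lemma adj_commute: "adj i j \<longleftrightarrow> adj j i"
  by (auto simp: adj_def)

lemma Union_\<T>: "\<Union>\<T> = P" and finite_\<T>: "finite \<T>"
  and face_Int_\<T>: "T \<in> \<T> \<Longrightarrow> T' \<in> \<T> \<Longrightarrow> (T \<inter> T') face_of T"
  using tri by (auto simp: polygon_triangulation_def triangulation_def)

lemma open_segment_subset_\<T>:
  assumes "T \<in> \<T>" "x \<in> T" "y \<in> T"
  shows "open_segment x y \<subseteq> T"
proof -
  have "convex T" using tri assms(1) by (auto simp: polygon_triangulation_def intro: convex_simplex)
  then show ?thesis using assms(2,3) by (simp add: convex_contains_open_segment)
qed

lemma \<T>_triangle:
  assumes T: "T \<in> \<T>"
  obtains K where "card K = 3" "T = convex hull (v ` K)" "\<forall>l. v l \<in> T \<longleftrightarrow> l \<in> K" "\<not> affine_dependent (v ` K)"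
proof -
  have "2 simplex T" and sub: "{x. x extreme_point_of T} \<subseteq> {x. x extreme_point_of P}"
    using tri T by (auto simp: polygon_triangulation_def)
  then obtain C where C: "\<not> affine_dependent C" "int (card C) = 3" "T = convex hull C"
    by (auto simp: simplex_def)
  have "C \<subseteq> range v"
    using extreme_point_of_convex_hull_affine_independent[OF C(1)] sub C(3) bij_v
    by (auto simp: bij_betw_def)
  then obtain K where K: "C = v ` K" by (meson subset_imageE)
  have "card K = 3" using C(2) K by (simp add: card_image inj_on_def)
  moreover have "v l \<in> T \<longleftrightarrow> l \<in> K" for l
  proof
    assume "v l \<in> T"
    then show "l \<in> K" unfolding C(3) K v_in_hull_iff .
  qed (simp add: C(3) K hull_inc)
  ultimately show ?thesis using that C K by auto
qed

lemma \<T>_third_vertex: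
  assumes T: "T \<in> \<T>" "v i \<in> T" "v j \<in> T" "i \<noteq> j"
  obtains k where "k \<noteq> i" "k \<noteq> j" "T = convex hull {v i, v j, v k}"
    "\<forall>l. v l \<in> T \<longleftrightarrow> l \<in> {i, j, k}" "\<not> affine_dependent {v i, v j, v k}"
proof -
  obtain K where K: "card K = 3" "T = convex hull (v ` K)" "\<forall>l. v l \<in> T \<longleftrightarrow> l \<in> K" "\<not> affine_dependent (v ` K)"
    using \<T>_triangle[OF T(1)] .
  have "i \<in> K" "j \<in> K" using K(3) T by auto
  then have "card (K - {i, j}) = 1" using K(1) T(4) by (simp add: card_Diff_subset)
  then obtain k where "K - {i, j} = {k}" by (auto simp: card_1_singleton_iff)
  then have "K = {i, j, k}" "k \<noteq> i" "k \<noteq> j" using \<open>i \<in> K\<close> \<open>j \<in> K\<close> by auto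
  then show ?thesis using that[of k] K by simp
qed

text \<open>The crossing point lies in a triangle on \<open>i k\<close> and in one on
  \<open>u w\<close>. They meet in a face, so the first also contains \<open>u\<close> and
  \<open>w\<close>; but it has only one vertex besides \<open>i\<close> and
  \<open>k\<close>.\<close>

lemma adj_no_cross:
  assumes "adj i k" "adj u w" "ori i k u > 0" "ori i k w < 0"
  shows False
proof -
  obtain q where q: "q \<in> open_segment (v i) (v k)" "q \<in> open_segment (v u) (v w)"
    using segments_cross assms by blast
  obtain T T' where T: "T \<in> \<T>" "v i \<in> T" "v k \<in> T" "i \<noteq> k" and T': "T' \<in> \<T>" "v u \<in> T'" "v w \<in> T'"
    using assms(1,2) by (auto simp: adj_def)
  have "q \<in> T" "q \<in> T'" using open_segment_subset_\<T> q T T' by blast+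
  then have uw: "v u \<in> T" "v w \<in> T"
    using face_ofD[OF face_Int_\<T>[OF T'(1) T(1)] q(2) T'(2,3)] by auto
  obtain l where "l \<noteq> i" "l \<noteq> k" "T = convex hull {v i, v k, v l}"
    "\<forall>m. v m \<in> T \<longleftrightarrow> m \<in> {i, k, l}" "\<not> affine_dependent {v i, v k, v l}"
    using \<T>_third_vertex[OF T] .
  then have "u \<in> {i, k, l}" "w \<in> {i, k, l}" using uw by auto
  then show False using assms(3,4) by (auto simp: ori_def)
qed

text \<open>Approach the midpoint of \<open>i j\<close> from a vertex on the left. Since the
  triangles are finitely many and closed, one that meets this path also contains the midpoint; it
  must have \<open>i j\<close> as a side and its third vertex on the left.\<close>

lemma adj_triangle_left:
  assumes "adj i j" "left i j \<noteq> {}"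
  obtains k where "k \<in> left i j" "adj i k" "adj k j"
proof -
  obtain u where u: "ori i j u > 0" using assms(2) by (auto simp: left_def)
  obtain T0 where T0: "T0 \<in> \<T>" "v i \<in> T0" "v j \<in> T0" and ij: "i \<noteq> j"
    using assms(1) by (auto simp: adj_def)
  define m where "m = midpoint (v i) (v j)"
  have m: "m \<in> open_segment (v i) (v j)" using ij by (simp add: m_def)
  have om: "orient (v i) (v j) m = 0"
    using orient_affine[of "1 / 2" "1 / 2" 0 "v i" "v j" "v i" "v j" 0]
    by (simp add: m_def midpoint_def scaleR_add_right inverse_eq_divide)
  have mu: "m \<noteq> v u" using om u by (auto simp: ori_def)
  let ?A = "open_segment m (v u)"
  have "m \<in> T0" using m T0 open_segment_subset_\<T> by blast
  then have "m \<in> P" using Union_\<T> T0(1) by blast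
  then have "?A \<subseteq> P" using v_in_P convex_P by (simp add: convex_contains_open_segment)
  then have "?A \<subseteq> \<Union>{T \<in> \<T>. T \<inter> ?A \<noteq> {}}" using Union_\<T> by blast
  moreover have "closed T" if "T \<in> \<T>" for T
    using tri that by (auto simp: polygon_triangulation_def intro: closed_simplex)
  then have "closed (\<Union>{T \<in> \<T>. T \<inter> ?A \<noteq> {}})" using finite_\<T> by (intro closed_Union) auto
  ultimately have "closure ?A \<subseteq> \<Union>{T \<in> \<T>. T \<inter> ?A \<noteq> {}}" by (rule closure_minimal)
  moreover have "m \<in> closure ?A" using mu by simp
  ultimately obtain T where T: "T \<in> \<T>" "m \<in> T" "T \<inter> ?A \<noteq> {}" by blast
  \<comment> \<open>\<open>T0 \<inter> T\<close> is a face of \<open>T0\<close> containing an inner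
    point of the segment, hence both ends.\<close>
  have iT: "v i \<in> T" "v j \<in> T"
    using face_ofD[OF face_Int_\<T>[OF T0(1) T(1)] m T0(2,3)] \<open>m \<in> T0\<close> T(2) by auto
  obtain k where k: "k \<noteq> i" "k \<noteq> j" "T = convex hull {v i, v j, v k}"
    by (rule \<T>_third_vertex[OF T(1) iT ij])
  obtain x where x: "x \<in> T" "x \<in> ?A" using T(3) by blast
  obtain s where s: "0 < s" "s < 1" "x = (1 - s) *\<^sub>R m + s *\<^sub>R v u"
    using x(2) by (auto simp: in_segment)
  have "orient (v i) (v j) x = s * ori i j u"
    using orient_affine[of "1 - s" s 0 "v i" "v j" m "v u" 0] by (simp add: s(3) om ori_def)
  then have pos: "orient (v i) (v j) x > 0" using s u by simp
  obtain a b c where abc: "0 \<le> c" "a + b + c = 1" "x = a *\<^sub>R v i + b *\<^sub>R v j + c *\<^sub>R v k"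
    using x(1) unfolding k(3) convex_hull_3 by blast
  \<comment> \<open>The form is affine and vanishes at \<open>v i\<close> and
    \<open>v j\<close>.\<close>
  have "orient (v i) (v j) x = c * ori i j k"
    using orient_affine[OF abc(2), of "v i" "v j"] by (simp add: abc(3) ori_def)
  then have "k \<in> left i j" using pos abc(1) by (simp add: left_def zero_less_mult_iff)
  moreover have "v k \<in> T" using k(3) by (simp add: hull_inc)
  then have "adj i k" "adj k j" using T(1) iT k by (auto simp: adj_def)
  ultimately show ?thesis using that by blast
qed

definition edges_on :: "'k set \<Rightarrow> 'k set set" where
  "edges_on W = {{a, b} | a b. a \<in> W \<and> b \<in> W \<and> adj a b}"

lemma edges_on_mono: "V \<subseteq> W \<Longrightarrow> edges_on V \<subseteq> edges_on W"
  by (auto simp: edges_on_def)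

text \<open>Split off the triangle \<open>i j k\<close> on the left of \<open>i j\<close>; an edge
  joining the two remaining parts away from \<open>k\<close>, other than \<open>i j\<close>, would
  cross \<open>i k\<close> or \<open>k j\<close>. Each triangle uses up one vertex as its apex, so
  \<open>card (left i j)\<close> counts triangles.\<close>

lemma triangle_tree_left:
  assumes "adj i j"
  shows "triangle_tree (edges_on (insert i (insert j (left i j)))) i j (card (left i j))"
  using assms
proof (induction "card (left i j)" arbitrary: i j rule: less_induct)
  case less
  have ij: "i \<noteq> j" using less.prems by (simp add: adj_def)
  show ?case
  proof (cases "left i j = {}")
    case True
    have "edges_on {i, j} = {{i, j}}" using less.prems by (auto simp: edges_on_def adj_def insert_commute)
    then show ?thesis using True ij by (simp add: triangle_tree.single)
  next
    case False
    obtain k where k: "k \<in> left i j" "adj i k" "adj k j" using adj_triangle_left[OF less.prems False] .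
    note sp = left_split[OF k(1)]
    let ?E = "edges_on (insert i (insert k (left i k)))" and ?F = "edges_on (insert k (insert j (left k j)))"
    have "finite (left a b)" for a b by simp
    then have card: "card (left i j) = Suc (card (left i k) + card (left k j))"
      using sp(1,5,6,7) by (simp add: card_Un_disjoint)
    have E: "triangle_tree ?E i k (card (left i k))" and F: "triangle_tree ?F k j (card (left k j))"
      using less.hyps k(2,3) card by simp_all
    have "\<Union>?E \<inter> \<Union>?F \<subseteq> {k}" unfolding sp(2)[symmetric] by (auto simp: edges_on_def)
    moreover have "k \<in> \<Union>?E" "k \<in> \<Union>?F"
      using triangle_tree_edges(3)[OF E] triangle_tree_edges(3)[OF F] by auto
    ultimately have EF: "\<Union>?E \<inter> \<Union>?F = {k}" by blast
    have "edges_on (insert i (insert j (left i j))) = insert {i, j} (?E \<union> ?F)"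
    proof (intro equalityI subsetI)
      fix e assume "e \<in> edges_on (insert i (insert j (left i j)))"
      then obtain a b where ab: "e = {a, b}" "adj a b" "a \<in> insert i (insert j (left i j))" "b \<in> insert i (insert j (left i j))"
        by (auto simp: edges_on_def)
      have cross1: False if "adj x y" "x \<in> left i k" "y \<in> insert j (left k j)" for x y
        using adj_no_cross[OF k(2) that(1)] sp(3)[OF that(2,3)] that(2) by (simp add: left_def)
      have cross2: False if "adj x y" "x \<in> left k j" "y \<in> insert i (left i k)" for x y
        using adj_no_cross[OF k(3) that(1)] sp(4)[OF that(2,3)] that(2) by (simp add: left_def)
      have "adj b a" using ab(2) by (simp add: adj_commute)
      have cases: "x = i \<or> x = j \<or> x = k \<or> x \<in> left i k \<or> x \<in> left k j" if "x \<in> insert i (insert j (left i j))" for x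
        using that unfolding sp(1) by auto
      have "{a, b} = {i, j} \<or> (a \<in> insert i (insert k (left i k)) \<and> b \<in> insert i (insert k (left i k))) \<or>
          (a \<in> insert k (insert j (left k j)) \<and> b \<in> insert k (insert j (left k j)))"
        using cases[OF ab(3)] cases[OF ab(4)] cross1[OF ab(2)] cross1[OF \<open>adj b a\<close>] cross2[OF ab(2)] cross2[OF \<open>adj b a\<close>]
        by blast
      then show "e \<in> insert {i, j} (?E \<union> ?F)" using ab(1,2) by (auto simp: edges_on_def)
    next
      fix e assume "e \<in> insert {i, j} (?E \<union> ?F)"
      moreover have "{i, j} \<in> edges_on (insert i (insert j (left i j)))"
        using less.prems by (auto simp: edges_on_def)
      moreover have "?E \<subseteq> edges_on (insert i (insert j (left i j)))" "?F \<subseteq> edges_on (insert i (insert j (left i j)))"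
        by (rule edges_on_mono; auto simp: sp(1))+
      ultimately show "e \<in> edges_on (insert i (insert j (left i j)))" by blast
    qed
    then show ?thesis using triangle_tree.glue[OF E F EF] card by simp
  qed
qed

section \<open>Sides of the polygon and the skeleton graph\<close>

lemma side_imp_adj:
  assumes S: "closed_segment (v i) (v j) face_of P" and ij: "i \<noteq> j"
  shows "adj i j"
proof -
  let ?S = "closed_segment (v i) (v j)" and ?m = "midpoint (v i) (v j)"
  have m: "?m \<in> ?S" by simp
  then have "?m \<in> P" using face_of_imp_subset[OF S] by blast
  then obtain T where T: "T \<in> \<T>" "?m \<in> T" using Union_\<T> by blast
  obtain K where K: "T = convex hull (v ` K)" by (rule \<T>_triangle[OF T(1)])
  have TP: "T \<subseteq> P" using T(1) Union_\<T> by blast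
  \<comment> \<open>This face of \<open>T\<close> is spanned by vertices of \<open>T\<close> lying
    on the side. As it contains the midpoint, both ends must be among them.\<close>
  have "(?S \<inter> T) face_of T"
    using face_of_slice[OF S, of T] TP K by (simp add: Int_absorb1)
  then obtain C where C: "C \<subseteq> v ` K" "?S \<inter> T = convex hull C"
    using face_of_convex_hull_subset[of "v ` K"] K by (metis finite_imageI finite finite_imp_compact)
  have "C \<subseteq> {v i, v j}"
  proof
    fix x assume x: "x \<in> C"
    then obtain l where l: "x = v l" using C(1) by blast
    have "v l \<in> convex hull {v i, v j}"
      using x C(2) l hull_inc[of x C convex] by (auto simp: segment_convex_hull)
    then have "l \<in> {i, j}" by (simp only: v_in_hull_2_iff)
    then show "x \<in> {v i, v j}" using l by auto
  qed
  moreover have mC: "?m \<in> convex hull C" using m T(2) C(2) by blast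
  moreover have "\<not> C \<subseteq> {x}" if "?m \<noteq> x" for x
    using mC hull_mono[of C "{x}" convex] that by auto
  then have "\<not> C \<subseteq> {v i}" "\<not> C \<subseteq> {v j}" using ij by simp_all
  ultimately have "C = {v i, v j}" by blast
  then have "v i \<in> T" "v j \<in> T" using C(2) hull_inc[of _ C convex] by auto
  then show ?thesis using T(1) ij by (auto simp: adj_def)
qed

lemma edge_of_P:
  assumes "S edge_of P"
  obtains i j where "i \<noteq> j" "S = closed_segment (v i) (v j)"
proof -
  have S: "S face_of P" "aff_dim S = 1" using assms by (auto simp: edge_of_def)
  have "polytope S" using face_of_polytope_polytope[OF polytope_P S(1)] .
  moreover have "S \<noteq> {}" "collinear S" using S(2) by (auto simp: collinear_aff_dim)
  ultimately obtain a b where ab: "S = closed_segment a b"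
    using compact_convex_collinear_segment polytope_imp_compact polytope_imp_convex by metis
  have "a \<noteq> b" using S(2) ab by auto
  have "a extreme_point_of P" "b extreme_point_of P"
    using extreme_point_of_face[OF S(1)] ab by (auto simp: extreme_point_of_segment)
  moreover have "{x. x extreme_point_of P} = range v" using bij_v by (simp add: bij_betw_def)
  ultimately obtain i j where "a = v i" "b = v j" by blast
  then show ?thesis using ab \<open>a \<noteq> b\<close> by (intro that[of i j]) simp_all
qed

text \<open>Any two vertices of a triangle span one of its edges, and a side of \<open>P\<close> is
  an edge of some triangle, so sharing a triangle describes sides and diagonals alike.\<close>

lemma skeleton_edges_eq: "skeleton_edges v P \<T> = edges_on UNIV"
proof -
  have "closed_segment (v i) (v j) \<in> polygon_sides P \<union> diagonals_used P \<T> \<longleftrightarrow> adj i j" if ij: "i \<noteq> j" for i j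
  proof
    assume "closed_segment (v i) (v j) \<in> polygon_sides P \<union> diagonals_used P \<T>"
    then consider "closed_segment (v i) (v j) edge_of P" | T where "T \<in> \<T>" "closed_segment (v i) (v j) edge_of T"
      unfolding polygon_sides_def diagonals_used_def by blast
    then show "adj i j"
    proof cases
      case 1
      then show ?thesis using side_imp_adj ij by (simp add: edge_of_def)
    next
      case 2
      then have "v i \<in> T" "v j \<in> T" using edge_of_imp_subset by fastforce+
      then show ?thesis using 2(1) ij by (auto simp: adj_def)
    qed
  next
    assume "adj i j"
    then obtain T where T: "T \<in> \<T>" "v i \<in> T" "v j \<in> T" by (auto simp: adj_def)
    obtain k where k: "T = convex hull {v i, v j, v k}" "\<not> affine_dependent {v i, v j, v k}"
      by (rule \<T>_third_vertex[OF T ij])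
    have "closed_segment (v i) (v j) face_of T"
      unfolding k(1) face_of_convex_hull_affine_independent[OF k(2)] segment_convex_hull
      by (intro exI[of _ "{v i, v j}"]) simp
    moreover have "aff_dim (closed_segment (v i) (v j)) = 1"
      using ij by (simp add: segment_convex_hull aff_dim_convex_hull)
    ultimately have "closed_segment (v i) (v j) edge_of T" by (simp add: edge_of_def)
    then show "closed_segment (v i) (v j) \<in> polygon_sides P \<union> diagonals_used P \<T>"
      using T(1) unfolding diagonals_used_def by blast
  qed
  then have "i \<noteq> j \<and> closed_segment (v i) (v j) \<in> polygon_sides P \<union> diagonals_used P \<T> \<longleftrightarrow> adj i j" for i j
    by (auto simp: adj_def)
  then show ?thesis by (simp only: skeleton_edges_def edges_on_def UNIV_I simp_thms)
qed

lemma skeleton_triangle_tree: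
  assumes "S edge_of P"
  obtains i j where "triangle_tree (skeleton_edges v P \<T>) i j (CARD('k) - 2)"
proof -
  obtain i j where ij: "i \<noteq> j" "S = closed_segment (v i) (v j)" using edge_of_P[OF assms] .
  have S: "S face_of P" using assms by (simp add: edge_of_def)
  have adj: "adj i j" using side_imp_adj ij S by simp
  \<comment> \<open>A segment between vertices on opposite sides would cross \<open>S\<close>; as
    \<open>S\<close> is a face, its ends would lie in \<open>S\<close>. So a suitable direction of
    the side has all other vertices on its left.\<close>
  have one_side: "left a b = {} \<or> left b a = {}" if "S = closed_segment (v a) (v b)" for a b
  proof (rule ccontr)
    assume "\<not> ?thesis"
    then obtain u w where uw: "ori a b u > 0" "ori a b w < 0"
      by (auto simp: left_def ori_swap[of b a])
    then obtain q where q: "q \<in> open_segment (v a) (v b)" "q \<in> open_segment (v u) (v w)"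
      using segments_cross by blast
    have "q \<in> S" using q(1) that open_closed_segment by auto
    then have "v u \<in> S" using face_ofD[OF S q(2)] v_in_P by blast
    then have "u \<in> {a, b}" unfolding that segment_convex_hull v_in_hull_2_iff .
    then show False using uw(1) by (auto simp: ori_def)
  qed
  have tree: "triangle_tree (skeleton_edges v P \<T>) a b (CARD('k) - 2)" if "adj a b" "left b a = {}" for a b
  proof -
    have ab: "a \<noteq> b" using that(1) by (simp add: adj_def)
    have "u \<in> left a b \<longleftrightarrow> u \<notin> {a, b}" for u
    proof -
      have "u \<notin> left b a" using that(2) by simp
      then have "0 \<le> ori a b u" by (simp add: left_def ori_swap[of a b])
      then show ?thesis using ab ori_eq_0_iff[of a b u] by (auto simp: left_def less_le)
    qed
    then have L: "left a b = - {a, b}" by auto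
    have "card (left a b) = CARD('k) - 2" unfolding L Compl_eq_Diff_UNIV using ab by (simp add: card_Diff_subset)
    moreover have "insert a (insert b (left a b)) = UNIV" unfolding L by auto
    ultimately show ?thesis using triangle_tree_left[OF that(1)] by (simp add: skeleton_edges_eq)
  qed
  show ?thesis using tree[OF adj] tree[of j i] adj adj_commute one_side[OF ij(2)] that by blast
qed

end

theorem theorem3p2:
  fixes n :: nat
    and P :: "(real^2) set"
    and \<T> :: "(real^2) set set"
    and v :: "'k::finite \<Rightarrow> real^2"
  assumes "n \<ge> 1"
    and "CARD('k) = n + 2"
    and "polygon (n + 2) P"
    and "bij_betw v UNIV {x. x extreme_point_of P}"
    and "polygon_triangulation P \<T>"
  shows "real (num_faces (graphical_zonotope (skeleton_edges v P \<T>))) =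
           (vector [1, 1] :: real^2) \<bullet>
             (matrix_power (vector [vector [1, 1], vector [2, 4]]) n *v vector [1, 2])
       \<and> (vector [1, 1] :: real^2) \<bullet>
             (matrix_power (vector [vector [1, 1], vector [2, 4]]) n *v vector [1, 2]) =
           3 * (\<Sum>m | real n / 2 \<le> real m \<and> m \<le> n.
                  real (m choose (n - m)) * 5 ^ (2 * m - n) * (-2) ^ (n - m))
           - 2 * (\<Sum>m | (real n - 1) / 2 \<le> real m \<and> m \<le> n - 1.
                  real (m choose (n - m - 1)) * 5 ^ (2 * m + 1 - n) * (-2) ^ (n - m - 1))"
proof -
  interpret triangulated_polygon P \<T> v
    using assms(3-5) by unfold_locales (simp_all add: polygon_def)
  have "card {e. e edge_of P} \<noteq> 0" using assms(3) by (simp add: polygon_def)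
  then obtain S where "S edge_of P" by fastforce
  then obtain i j where tree: "triangle_tree (skeleton_edges v P \<T>) i j n"
    using skeleton_triangle_tree assms(2) by (metis add_diff_cancel_right')
  have "num_faces (graphical_zonotope (skeleton_edges v P \<T>)) = card (range (cmp_pairs (skeleton_edges v P \<T>)))"
    using triangle_tree_edges(2)[OF tree] by (intro num_faces_graphical_zonotope) blast
  also have "\<dots> = fst (state_count n) + 2 * snd (state_count n)"
    using card_range_cmp_pairs_triangle_tree[OF tree] .
  finally have "real (num_faces (graphical_zonotope (skeleton_edges v P \<T>))) =
      (vector [1, 1] :: real^2) \<bullet>
        (matrix_power (vector [vector [1, 1], vector [2, 4]]) n *v vector [1, 2])"
    unfolding matrix_power_state_count by (simp add: inner_vec_def sum_2)
  then show ?thesis using matrix_formula_eq_binomial_formula[OF assms(1)] by simp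
qed

end
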